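(* Let $M\subseteq\mathbb{R}^d$ be a free $\mathbb{Z}$-module spanning $\mathbb{R}^d$. The map \[ \phi:\mathrm{OS}(M)\to\mathbb{R}^+/\big(\mathrm{scal}_M(E)\cap\mathbb{R}^+\big),\qquad R\mapsto \mathrm{scal}_M(R)\cap\mathbb{R}^+ \] (where $\mathrm{scal}_M(R)\cap\mathbb{R}^+$ is a coset of the multiplicative subgroup $\mathrm{scal}_M(E)\cap\mathbb{R}^+$ of $\mathbb{R}^+$) is a group homomorphism whose kernel is $\mathrm{OC}(M)$. Consequently $\mathrm{OC}(M)$ is a normal subgroup of $\mathrm{OS}(M)$ and $\mathrm{OS}(M)/\mathrm{OC}(M)$ is Abelian.
   Context: A free $\mathbb{Z}$-module in $\mathbb{R}^d$ is $M=\langle t_1,\dots,t_k\rangle_{\mathbb{Z}}$ with $t_1,\dots,t_k\in\mathbb{R}^d$ rationally independent and spanning $\mathbb{R}^d$. Modules $M_1,M_2$ are commensurate, $M_1\sim M_2$, if $M_1\cap M_2$ has finite index in both. $\mathrm{OS}(M)=\{R\in\mathrm{O}(d,\mathbb{R})\mid\exists\,\alpha\in\mathbb{R}^+,\ \alpha RM\subseteq M\}$, $\mathrm{OC}(M)=\{R\in\mathrm{O}(d,\mathbb{R})\mid M\sim RM\}$. For $R\in\mathrm{O}(d,\mathbb{R})$, $\mathrm{scal}_M(R)=\{\alpha\in\mathbb{R}\mid\alpha RM\sim M\}$; $E$ is the identity and $\mathrm{scal}_M(E)$ is a field. $\mathbb{R}^+$ is the multiplicative group of positive reals. *)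

theory Defs
  imports "HOL-Analysis.Analysis" "HOL-Algebra.Coset"
begin

interpretation int_vec: module "\<lambda>(n::int) (v::real^'d). of_int n *\<^sub>R v"
  by unfold_locales (auto simp: algebra_simps)

interpretation rat_vec: vector_space "\<lambda>(q::rat) (v::real^'d). of_rat q *\<^sub>R v"
  by unfold_locales (auto simp: algebra_simps of_rat_add of_rat_mult)

text \<open>The set \<open>B\<close> plays the role of \<open>{t\<^sub>1, \<dots>, t\<^sub>k}\<close>: the \<open>t\<^sub>i\<close> are rationally independent,
  hence distinct. The unqualified \<^const>\<open>span\<close> is the real one.\<close>

definition free_Z_module :: "(real^'d) set \<Rightarrow> bool" where
  "free_Z_module M \<longleftrightarrow>
     (\<exists>B. finite B \<and> rat_vec.independent B \<and> span B = UNIV \<and> M = int_vec.span B)"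

definition additive_group :: "'a::ab_group_add set \<Rightarrow> 'a monoid" where
  "additive_group M = \<lparr>carrier = M, monoid.mult = (+), one = 0\<rparr>"

definition finite_index :: "'a::ab_group_add set \<Rightarrow> 'a set \<Rightarrow> bool" where
  "finite_index N M \<longleftrightarrow> finite (rcosets\<^bsub>additive_group M\<^esub> N)"

definition commensurate :: "'a::ab_group_add set \<Rightarrow> 'a set \<Rightarrow> bool" where
  "commensurate M\<^sub>1 M\<^sub>2 \<longleftrightarrow> finite_index (M\<^sub>1 \<inter> M\<^sub>2) M\<^sub>1 \<and> finite_index (M\<^sub>1 \<inter> M\<^sub>2) M\<^sub>2"

definition scaled_image :: "real \<Rightarrow> real^'d^'d \<Rightarrow> (real^'d) set \<Rightarrow> (real^'d) set" where
  "scaled_image \<alpha> R M = (\<lambda>v. \<alpha> *\<^sub>R (R *v v)) ` M"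

definition OS :: "(real^'d) set \<Rightarrow> (real^'d^'d) set" where
  "OS M = {R. orthogonal_matrix R \<and> (\<exists>\<alpha>>0. scaled_image \<alpha> R M \<subseteq> M)}"

definition OC :: "(real^'d) set \<Rightarrow> (real^'d^'d) set" where
  "OC M = {R. orthogonal_matrix R \<and> commensurate M ((*v) R ` M)}"

definition scal :: "(real^'d) set \<Rightarrow> real^'d^'d \<Rightarrow> real set" where
  "scal M R = {\<alpha>. commensurate (scaled_image \<alpha> R M) M}"

definition orthogonal_group :: "(real^'d^'d) monoid" where
  "orthogonal_group = \<lparr>carrier = {R. orthogonal_matrix R}, monoid.mult = (**), one = mat 1\<rparr>"

definition OS_group :: "(real^'d) set \<Rightarrow> (real^'d^'d) monoid" where
  "OS_group M = orthogonal_group\<lparr>carrier := OS M\<rparr>"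

definition pos_reals :: "real monoid" where
  "pos_reals = \<lparr>carrier = {0<..}, monoid.mult = (*), one = 1\<rparr>"

definition scal_pos :: "(real^'d) set \<Rightarrow> real^'d^'d \<Rightarrow> real set" where
  "scal_pos M R = scal M R \<inter> {0<..}"

end

theory Submission imports Defs begin

text \<open>Let \<open>V\<close> be the rational span of \<open>M\<close>, a finite-dimensional rational vector space.
  Finitely generated subgroups are commensurate iff they have the same rational span, so a
  positive \<open>\<alpha>\<close> lies in \<open>scal M R\<close> iff \<open>\<alpha>RV = V\<close>. Since \<open>\<alpha>R\<close> is injective, a dimension
  count shows that \<open>\<alpha>RV = V\<close> as soon as \<open>\<alpha>RM \<subseteq> M\<close>. All claims then reduce to
  composing the maps \<open>\<alpha>R\<close> that stabilise \<open>V\<close>.\<close>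

section \<open>Integer spans inside rational spans: clearing denominators\<close>

lemma rat_subspace_imp_int_subspace:
  fixes V :: "(real^'d) set"
  assumes "rat_vec.subspace V"
  shows "int_vec.subspace V"
  unfolding int_vec.subspace_def
proof (intro conjI allI ballI)
  fix n :: int and v assume "v \<in> V"
  then have "of_rat (of_int n) *\<^sub>R v \<in> V"
    using assms by (intro rat_vec.subspace_scale)
  then show "of_int n *\<^sub>R v \<in> V" by simp
qed (use assms in \<open>auto intro: rat_vec.subspace_0 rat_vec.subspace_add\<close>)

text \<open>Lets the rational span of a module be computed from a finite generating set, where
  independence and dimension arguments apply.\<close>

lemma rat_span_int_span:
  fixes B :: "(real^'d) set"
  shows "rat_vec.span (int_vec.span B) = rat_vec.span B"
proof
  have "int_vec.span B \<subseteq> rat_vec.span B"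
    by (intro int_vec.span_minimal rat_vec.span_superset rat_subspace_imp_int_subspace
        rat_vec.subspace_span)
  then show "rat_vec.span (int_vec.span B) \<subseteq> rat_vec.span B"
    by (intro rat_vec.span_minimal rat_vec.subspace_span)
  show "rat_vec.span B \<subseteq> rat_vec.span (int_vec.span B)"
    by (intro rat_vec.span_mono int_vec.span_superset)
qed

lemma nat_scale_mem:
  fixes N :: "(real^'d) set"
  assumes "int_vec.subspace N" "v \<in> N"
  shows "real k *\<^sub>R v \<in> N"
  using int_vec.subspace_scale[OF assms, of "int k"] by simp

text \<open>Clearing denominators: the vectors with a positive integer multiple in \<open>N\<close>
  form a rational subspace containing \<open>N\<close>, so they exhaust the rational span.
  Conversely, such a multiple can be divided by \<open>m\<close> within the span.\<close>

lemma rat_span_int_subspace: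
  fixes N :: "(real^'d) set"
  assumes N: "int_vec.subspace N"
  shows "v \<in> rat_vec.span N \<longleftrightarrow> (\<exists>m>0. real m *\<^sub>R v \<in> N)"
proof
  let ?S = "{v. \<exists>m>0. real m *\<^sub>R v \<in> N}"
  have "rat_vec.subspace ?S"
    unfolding rat_vec.subspace_def
  proof (intro conjI allI ballI)
    show "0 \<in> ?S"
      using int_vec.subspace_0[OF N] by (auto intro: exI[of _ 1])
  next
    fix x y assume "x \<in> ?S" "y \<in> ?S"
    then obtain m n where mn: "m > 0" "n > 0" "real m *\<^sub>R x \<in> N" "real n *\<^sub>R y \<in> N"
      by blast
    have "real n *\<^sub>R (real m *\<^sub>R x) + real m *\<^sub>R (real n *\<^sub>R y) \<in> N"
      by (intro int_vec.subspace_add[OF N] nat_scale_mem[OF N mn(3)] nat_scale_mem[OF N mn(4)])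
    then have "real (m * n) *\<^sub>R (x + y) \<in> N"
      by (simp add: algebra_simps)
    then show "x + y \<in> ?S"
      using mn by (auto intro!: exI[of _ "m * n"])
  next
    fix q :: rat and x assume "x \<in> ?S"
    then obtain m where m: "m > 0" "real m *\<^sub>R x \<in> N" by blast
    \<comment> \<open>With q = a / b, the multiplier m * b works for q x, since (m b)(q x) = a (m
      x).\<close>
    obtain a b where ab: "q = of_int a / of_int b" "b > 0"
      by (metis quotient_of_div quotient_of_denom_pos surj_pair)
    have "of_int a *\<^sub>R (real m *\<^sub>R x) \<in> N"
      using m int_vec.subspace_scale[OF N] by blast
    moreover have "of_int a *\<^sub>R (real m *\<^sub>R x) = real (m * nat b) *\<^sub>R (of_rat q *\<^sub>R x)"
      using ab by (simp add: of_rat_divide)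
    ultimately show "of_rat q *\<^sub>R x \<in> ?S"
      using m ab by (auto intro!: exI[of _ "m * nat b"] simp del: scaleR_scaleR)
  qed
  moreover have "N \<subseteq> ?S"
    by (auto intro!: exI[of _ 1])
  ultimately have "rat_vec.span N \<subseteq> ?S"
    by (intro rat_vec.span_minimal)
  then show "v \<in> rat_vec.span N \<Longrightarrow> \<exists>m>0. real m *\<^sub>R v \<in> N"
    by blast
next
  assume "\<exists>m>0. real m *\<^sub>R v \<in> N"
  then obtain m where m: "m > 0" "real m *\<^sub>R v \<in> N" by blast
  then have "of_rat (1 / of_nat m) *\<^sub>R (real m *\<^sub>R v) \<in> rat_vec.span N"
    by (intro rat_vec.span_scale rat_vec.span_base)
  then show "v \<in> rat_vec.span N"
    using m by (simp add: of_rat_divide)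
qed

text \<open>A finite set has a common denominator: multiply the multipliers of its elements, using
  that \<open>N\<close> is closed under integer multiples.\<close>

lemma common_multiple_mem:
  fixes N :: "(real^'d) set"
  assumes N: "int_vec.subspace N" and "finite B" "B \<subseteq> rat_vec.span N"
  shows "\<exists>m>0. \<forall>b\<in>B. real m *\<^sub>R b \<in> N"
  using assms(2,3)
proof (induction B)
  case empty
  then show ?case by auto
next
  case (insert b B)
  then obtain m where m: "m > 0" "\<forall>b\<in>B. real m *\<^sub>R b \<in> N" by auto
  obtain n where n: "n > 0" "real n *\<^sub>R b \<in> N"
    using insert.prems rat_span_int_subspace[OF N] by auto
  have "real (m * n) *\<^sub>R c \<in> N" if "c \<in> insert b B" for c
  proof (cases "c = b")
    case True
    then show ?thesis using nat_scale_mem[OF N n(2), of m] by simp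
  next
    case False
    then have "real n *\<^sub>R (real m *\<^sub>R c) \<in> N"
      using that m nat_scale_mem[OF N] by blast
    then show ?thesis by (simp add: mult.commute)
  qed
  then show ?case using m n by (intro exI[of _ "m * n"]) auto
qed

section \<open>Finite index and commensurability in terms of rational spans\<close>

lemma r_coset_additive_group: "N #>\<^bsub>additive_group M\<^esub> a = (\<lambda>h. h + a) ` N"
  by (auto simp: r_coset_def additive_group_def)

text \<open>From left to right, the pigeonhole principle puts two multiples of any vector into one
  coset. From right to left, a common denominator m of \<open>B\<close> sends m M into
  \<open>N\<close>, and M / m M is finite because coefficients matter only modulo m.\<close>

lemma finite_index_iff_rat_span:
  fixes B N :: "(real^'d) set"
  assumes B: "finite B" and N: "int_vec.subspace N"
  shows "finite_index (int_vec.span B \<inter> N) (int_vec.span B)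
    \<longleftrightarrow> int_vec.span B \<subseteq> rat_vec.span N"
proof -
  let ?M = "int_vec.span B"
  let ?C = "\<lambda>a. (\<lambda>h. h + a) ` (?M \<inter> N)"
  have rc: "finite_index (?M \<inter> N) ?M \<longleftrightarrow> finite (?C ` ?M)"
    unfolding finite_index_def RCOSETS_def r_coset_additive_group
    by (simp add: additive_group_def UNION_singleton_eq_range)
  have MN: "int_vec.subspace (?M \<inter> N)"
    by (intro int_vec.subspace_inter int_vec.subspace_span N)
  have C_eq: "?C a = ?C b" if "a - b \<in> ?M \<inter> N" for a b
  proof -
    have "?C x \<subseteq> ?C y" if "x - y \<in> ?M \<inter> N" for x y
    proof
      fix z assume "z \<in> ?C x"
      then obtain h where "h \<in> ?M \<inter> N" "z = h + x" by blast
      then show "z \<in> ?C y"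
        using int_vec.subspace_add[OF MN _ that, of h] by (intro image_eqI[of _ _ "h + (x - y)"]) auto
    qed
    from this[OF that] this[of b a] show ?thesis
      using int_vec.subspace_neg[OF MN that] by auto
  qed
  show ?thesis
  proof
    assume "finite_index (?M \<inter> N) ?M"
    then have fin: "finite (?C ` ?M)" using rc by simp
    show "?M \<subseteq> rat_vec.span N"
    proof
      fix v assume v: "v \<in> ?M"
      \<comment> \<open>The multiples of v meet only finitely many cosets, so i v and j v share one
        for some i < j; then (j - i) v lies in \<open>N\<close>, which puts v into the rational
        span.\<close>
      let ?f = "\<lambda>n::nat. ?C (real n *\<^sub>R v)"
      have "range ?f \<subseteq> ?C ` ?M"
        using v nat_scale_mem[OF int_vec.subspace_span v] by blast
      then have "\<not> inj ?f"
        using fin finite_subset range_inj_infinite by blast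
      then obtain i j where "i \<noteq> j" "?f i = ?f j"
        by (auto simp: inj_def)
      then obtain i j where ij: "i < j" "?f i = ?f j"
        by (metis linorder_neqE_nat)
      have "real j *\<^sub>R v \<in> ?f j"
        using int_vec.subspace_0[OF MN] by force
      then have "real j *\<^sub>R v \<in> ?f i"
        by (simp only: ij(2))
      then have "real (j - i) *\<^sub>R v \<in> N"
        using ij(1) by (auto simp: of_nat_diff algebra_simps)
      then show "v \<in> rat_vec.span N"
        using ij rat_span_int_subspace[OF N] zero_less_diff by blast
    qed
  next
    assume "?M \<subseteq> rat_vec.span N"
    then obtain m where m: "m > 0" "\<forall>b\<in>B. real m *\<^sub>R b \<in> N"
      using common_multiple_mem[OF N B] int_vec.span_superset by blast
    let ?s = "\<lambda>c. \<Sum>b\<in>B. of_int (c b) *\<^sub>R b"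
    \<comment> \<open>Reducing the coefficients modulo m does not change the coset, so the finitely
      many coefficient functions from \<open>B\<close> to {0..<m} reach every coset.\<close>
    have "?C ` ?M \<subseteq> (\<lambda>c. ?C (?s c)) ` (PiE B (\<lambda>_. {0..<int m}))"
    proof safe
      fix v assume "v \<in> ?M"
      then obtain u where u: "v = ?s u"
        using int_vec.span_finite[OF B] by auto
      \<comment> \<open>The restriction makes the reduced coefficients extensional, as membership in
        \<open>PiE\<close> demands.\<close>
      let ?c = "restrict (\<lambda>b. u b mod int m) B"
      have "v - ?s ?c = (\<Sum>b\<in>B. of_int (u b - u b mod int m) *\<^sub>R b)"
        unfolding u by (simp add: sum_subtractf algebra_simps)
      also have "\<dots> = (\<Sum>b\<in>B. of_int (u b div int m) *\<^sub>R (real m *\<^sub>R b))"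
      proof (rule sum.cong[OF refl])
        fix b
        have "real_of_int (u b - u b mod int m) = real_of_int (u b div int m * int m)"
          by (simp only: minus_mod_eq_div_mult)
        then show "of_int (u b - u b mod int m) *\<^sub>R b = of_int (u b div int m) *\<^sub>R (real m *\<^sub>R b)"
          by simp
      qed
      also have "\<dots> \<in> ?M \<inter> N"
      proof (rule int_vec.subspace_sum[OF MN])
        fix b assume "b \<in> B"
        then have "real m *\<^sub>R b \<in> ?M \<inter> N"
          using m nat_scale_mem[OF int_vec.subspace_span int_vec.span_base] by blast
        then show "of_int (u b div int m) *\<^sub>R (real m *\<^sub>R b) \<in> ?M \<inter> N"
          by (rule int_vec.subspace_scale[OF MN])
      qed
      finally have "?C v = ?C (?s ?c)" by (rule C_eq)
      moreover have "?c \<in> PiE B (\<lambda>_. {0..<int m})"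
        using m by auto
      ultimately show "?C v \<in> (\<lambda>c. ?C (?s c)) ` (PiE B (\<lambda>_. {0..<int m}))"
        by blast
    qed
    moreover have "finite (PiE B (\<lambda>_. {0..<int m}))"
      using B by (intro finite_PiE) auto
    ultimately show "finite_index (?M \<inter> N) ?M"
      unfolding rc by (rule finite_subset[OF _ finite_imageI])
  qed
qed

text \<open>Each of the two finite-index conditions is one inclusion between the rational
  spans.\<close>

lemma commensurate_iff_rat_span_eq:
  fixes B C :: "(real^'d) set"
  assumes "finite B" "finite C"
  shows "commensurate (int_vec.span B) (int_vec.span C) \<longleftrightarrow> rat_vec.span B = rat_vec.span C"
proof -
  have sub: "int_vec.span X \<subseteq> rat_vec.span (int_vec.span Y) \<longleftrightarrow> rat_vec.span X \<subseteq> rat_vec.span Y"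
    for X Y :: "(real^'d) set"
  proof
    assume "int_vec.span X \<subseteq> rat_vec.span (int_vec.span Y)"
    then have "X \<subseteq> rat_vec.span Y"
      unfolding rat_span_int_span using int_vec.span_superset by blast
    then show "rat_vec.span X \<subseteq> rat_vec.span Y"
      by (rule rat_vec.span_minimal[OF _ rat_vec.subspace_span])
  next
    assume "rat_vec.span X \<subseteq> rat_vec.span Y"
    then show "int_vec.span X \<subseteq> rat_vec.span (int_vec.span Y)"
      using rat_vec.span_superset[of "int_vec.span X"] unfolding rat_span_int_span by blast
  qed
  have "commensurate (int_vec.span B) (int_vec.span C) \<longleftrightarrow>
      int_vec.span B \<subseteq> rat_vec.span (int_vec.span C) \<and>
      int_vec.span C \<subseteq> rat_vec.span (int_vec.span B)"
    unfolding commensurate_def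
    using finite_index_iff_rat_span[OF assms(1) int_vec.subspace_span, of C]
      finite_index_iff_rat_span[OF assms(2) int_vec.subspace_span, of B]
    by (simp add: Int_commute)
  then show ?thesis unfolding sub by blast
qed

section \<open>Scaled matrices acting on spans\<close>

lemma int_span_scaled_image:
  fixes R :: "real^'d^'d"
  shows "int_vec.span (scaled_image \<alpha> R B) = scaled_image \<alpha> R (int_vec.span B)"
proof -
  interpret module_hom "\<lambda>(n::int) (v::real^'d). of_int n *\<^sub>R v"
    "\<lambda>(n::int) (v::real^'d). of_int n *\<^sub>R v" "\<lambda>v. \<alpha> *\<^sub>R (R *v v)"
    by unfold_locales (simp_all add: matrix_vector_right_distrib scaleR_add_right
        matrix_vector_mult_scaleR)
  show ?thesis unfolding scaled_image_def by (rule span_image)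
qed

text \<open>Kept as a separate fact because both spans and independence are transported along this
  map.\<close>

lemma module_hom_scaled:
  fixes R :: "real^'d^'d"
  shows "module_hom (\<lambda>(q::rat) (v::real^'d). of_rat q *\<^sub>R v) (\<lambda>(q::rat) (v::real^'d). of_rat q *\<^sub>R v)
     (\<lambda>v. \<alpha> *\<^sub>R (R *v v))"
  by unfold_locales (simp_all add: matrix_vector_right_distrib scaleR_add_right
      matrix_vector_mult_scaleR)

lemma rat_span_scaled_image:
  fixes R :: "real^'d^'d"
  shows "rat_vec.span (scaled_image \<alpha> R B) = scaled_image \<alpha> R (rat_vec.span B)"
  unfolding scaled_image_def by (rule module_hom.span_image[OF module_hom_scaled])

text \<open>Scalars commute with matrices, so factors and matrices multiply separately; the
  multiplicativity of scaling factors rests on this.\<close>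

lemma scaled_image_scaled_image:
  "scaled_image \<alpha> R (scaled_image \<beta> S M) = scaled_image (\<alpha> * \<beta>) (R ** S) M"
  by (simp add: scaled_image_def image_image matrix_vector_mult_scaleR
      matrix_vector_mul_assoc)

lemma scaled_image_one: "scaled_image 1 (mat 1) M = M"
  by (simp add: scaled_image_def)

text \<open>Dimension count: the image of \<open>B\<close> is independent and as large as
  \<open>B\<close>. If it failed to span some b in \<open>B\<close>, adding b would give an
  independent set of size card B + 1 inside the span of \<open>B\<close>.\<close>

lemma scaled_image_subset_imp_eq:
  fixes R :: "real^'d^'d"
  assumes "finite B" "rat_vec.independent B" "orthogonal_matrix R" "\<alpha> > 0"
    and sub: "scaled_image \<alpha> R (rat_vec.span B) \<subseteq> rat_vec.span B"
  shows "scaled_image \<alpha> R (rat_vec.span B) = rat_vec.span B"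
proof -
  let ?S = "scaled_image \<alpha> R B"
  have inj: "inj (\<lambda>v. \<alpha> *\<^sub>R (R *v v))"
  proof (rule injI)
    fix x y assume "\<alpha> *\<^sub>R (R *v x) = \<alpha> *\<^sub>R (R *v y)"
    then have "transpose R *v (R *v x) = transpose R *v (R *v y)"
      using assms by simp
    then show "x = y"
      using assms by (simp add: matrix_vector_mul_assoc orthogonal_matrix_def)
  qed
  have ind: "rat_vec.independent ?S"
    unfolding scaled_image_def
    by (rule module_hom.independent_injective_image[OF module_hom_scaled assms(2)
          inj_on_subset[OF inj subset_UNIV]])
  have card: "card ?S = card B" and fin: "finite ?S"
    unfolding scaled_image_def using assms inj by (auto intro: card_image inj_on_subset)
  have S: "?S \<subseteq> rat_vec.span B"
    using sub rat_span_scaled_image rat_vec.span_superset by blast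
  have "rat_vec.span B \<subseteq> rat_vec.span ?S"
  proof (rule rat_vec.span_minimal[OF _ rat_vec.subspace_span], rule subsetI, rule ccontr)
    fix b assume b: "b \<in> B" "b \<notin> rat_vec.span ?S"
    then have "rat_vec.independent (insert b ?S)"
      using ind by (simp add: rat_vec.independent_insert)
    moreover have "insert b ?S \<subseteq> rat_vec.span B"
      using S b rat_vec.span_base by blast
    ultimately have "card (insert b ?S) \<le> card B"
      using rat_vec.independent_span_bound[OF assms(1)] by blast
    moreover have "b \<notin> ?S"
      using b rat_vec.span_base by blast
    ultimately show False
      using card fin by simp
  qed
  then show ?thesis
    using sub rat_span_scaled_image by blast
qed

section \<open>Scaling factors as a homomorphism to a quotient of the positive reals\<close>

theorem theorem20:
  fixes M :: "(real^'d) set"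
  assumes "free_Z_module M"
  shows "subgroup (scal_pos M (mat 1)) pos_reals
    \<and> group_hom (OS_group M) (pos_reals Mod scal_pos M (mat 1)) (scal_pos M)
    \<and> kernel (OS_group M) (pos_reals Mod scal_pos M (mat 1)) (scal_pos M) = OC M
    \<and> OC M \<lhd> OS_group M
    \<and> comm_group (OS_group M Mod OC M)"
proof -
  obtain B where B: "finite B" "rat_vec.independent B" "M = int_vec.span B"
    using assms by (auto simp: free_Z_module_def)
  define V where "V = rat_vec.span B"
  define H where "H = scal_pos M (mat 1)"
  \<comment> \<open>Commensurability becomes stability of the rational space \<open>V\<close>. Both
    argument orders are recorded because \<open>scal\<close> and \<open>OC\<close> use opposite
    ones.\<close>
  have comm: "commensurate (scaled_image \<alpha> R M) M \<longleftrightarrow> scaled_image \<alpha> R V = V"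
    and comm': "commensurate M (scaled_image \<alpha> R M) \<longleftrightarrow> scaled_image \<alpha> R V = V" for \<alpha> R
    unfolding B(3) int_span_scaled_image[symmetric] V_def rat_span_scaled_image[symmetric]
    using B(1) commensurate_iff_rat_span_eq[of B "scaled_image \<alpha> R B"]
      commensurate_iff_rat_span_eq[of "scaled_image \<alpha> R B" B]
    by (auto simp: scaled_image_def)
  have scal: "\<alpha> \<in> scal_pos M R \<longleftrightarrow> \<alpha> > 0 \<and> scaled_image \<alpha> R V = V" for \<alpha> R
    by (auto simp: scal_pos_def scal_def comm)
  have scal_mult: "\<alpha> * \<beta> \<in> scal_pos M (R ** S)"
    if "\<alpha> \<in> scal_pos M R" "\<beta> \<in> scal_pos M S" for \<alpha> \<beta> R S
    using that by (simp add: scal flip: scaled_image_scaled_image)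
  \<comment> \<open>The inverse of \<alpha> R is (1/\<alpha>) times the transpose of R, and it
    stabilises \<open>V\<close> along with \<alpha> R.\<close>
  have scal_inverse: "inverse \<alpha> \<in> scal_pos M (transpose R)"
    if R: "orthogonal_matrix R" and "\<alpha> \<in> scal_pos M R" for \<alpha> R
  proof -
    have \<alpha>: "\<alpha> > 0" "scaled_image \<alpha> R V = V"
      using that scal by auto
    have "scaled_image (inverse \<alpha>) (transpose R) V
        = scaled_image (inverse \<alpha>) (transpose R) (scaled_image \<alpha> R V)"
      by (simp add: \<alpha>)
    also have "\<dots> = V"
      using \<alpha>(1) R unfolding scaled_image_scaled_image
      by (simp add: orthogonal_matrix_def scaled_image_one)
    finally show ?thesis using \<alpha> by (simp add: scal)
  qed
  have scal_one: "1 \<in> scal_pos M (mat 1)"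
    by (simp add: scal scaled_image_one)
  \<comment> \<open>An inclusion \<alpha> R M \<subseteq> M extends to \<open>V\<close>, where the
    dimension count makes it an equality. Conversely, a factor stabilising \<open>V\<close> becomes
    one mapping \<open>M\<close> into itself after clearing denominators.\<close>
  have OS: "R \<in> OS M \<longleftrightarrow> orthogonal_matrix R \<and> scal_pos M R \<noteq> {}" for R
  proof
    assume "R \<in> OS M"
    then obtain \<alpha> where R: "orthogonal_matrix R" "\<alpha> > 0" "scaled_image \<alpha> R M \<subseteq> M"
      by (auto simp: OS_def)
    then have "scaled_image \<alpha> R V \<subseteq> V"
      unfolding V_def rat_span_int_span[of B, symmetric] B(3) rat_span_scaled_image[symmetric]
      by (intro rat_vec.span_mono)
    then show "orthogonal_matrix R \<and> scal_pos M R \<noteq> {}"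
      using R scaled_image_subset_imp_eq[OF B(1,2)] scal V_def by blast
  next
    assume "orthogonal_matrix R \<and> scal_pos M R \<noteq> {}"
    then obtain \<alpha> where R: "orthogonal_matrix R" and \<alpha>: "\<alpha> > 0" "scaled_image \<alpha> R V = V"
      using scal by auto
    have "scaled_image \<alpha> R B \<subseteq> rat_vec.span (int_vec.span B)"
      using \<alpha> rat_vec.span_superset
      unfolding V_def rat_span_int_span rat_span_scaled_image[symmetric] by blast
    \<comment> \<open>m is a common denominator of the finitely many vectors \<alpha> R b with b in
      \<open>B\<close>, so the factor m * \<alpha> sends the generators of \<open>M\<close>, and
      hence \<open>M\<close>, into \<open>M\<close>.\<close>
    then obtain m where m: "m > 0" "\<forall>b\<in>scaled_image \<alpha> R B. real m *\<^sub>R b \<in> M"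
      using common_multiple_mem[OF int_vec.subspace_span, of "scaled_image \<alpha> R B" B] B
      by (auto simp: scaled_image_def)
    have "scaled_image (m * \<alpha>) R B \<subseteq> M"
      using m(2) by (auto simp: scaled_image_def)
    then have "scaled_image (m * \<alpha>) R M \<subseteq> M"
      unfolding B(3) int_span_scaled_image[symmetric]
      by (intro int_vec.span_minimal int_vec.subspace_span)
    then show "R \<in> OS M"
      using R \<alpha> m by (auto simp: OS_def intro!: exI[of _ "m * \<alpha>"])
  qed
  have OC: "R \<in> OC M \<longleftrightarrow> orthogonal_matrix R \<and> 1 \<in> scal_pos M R" for R
    using comm'[of 1 R] by (auto simp: OC_def scal scaled_image_def)

  \<comment> \<open>Sets of scaling factors as cosets\<close>
  interpret P: comm_group pos_reals
  proof (rule comm_groupI)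
    fix x assume "x \<in> carrier pos_reals"
    then show "\<exists>y\<in>carrier pos_reals. y \<otimes>\<^bsub>pos_reals\<^esub> x = \<one>\<^bsub>pos_reals\<^esub>"
      by (intro bexI[of _ "inverse x"]) (simp_all add: pos_reals_def)
  qed (simp_all add: pos_reals_def)
  have P_inv: "inv\<^bsub>pos_reals\<^esub> x = inverse x" if "x > 0" for x
    using that by (intro P.inv_equality) (auto simp: pos_reals_def)
  have H_sub: "subgroup H pos_reals"
  proof
    show "H \<subseteq> carrier pos_reals"
      by (auto simp: H_def scal pos_reals_def)
    show "x \<otimes>\<^bsub>pos_reals\<^esub> y \<in> H" if "x \<in> H" "y \<in> H" for x y
      using that scal_mult[of x "mat 1" y "mat 1"] by (simp add: H_def pos_reals_def)
    show "\<one>\<^bsub>pos_reals\<^esub> \<in> H"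
      using scal_one by (simp add: H_def pos_reals_def)
    show "inv\<^bsub>pos_reals\<^esub> x \<in> H" if "x \<in> H" for x
    proof -
      have "x > 0" using that by (simp add: H_def scal)
      then show ?thesis
        using that scal_inverse[OF orthogonal_matrix_id] by (simp add: P_inv H_def transpose_mat)
    qed
  qed
  interpret H: normal H pos_reals
    by (rule P.subgroup_imp_normal[OF H_sub])
  \<comment> \<open>Any factor \<alpha> of R may serve as representative: dividing another factor of
    R by \<alpha> gives a factor of R times its transpose, which is the identity, and multiplying
    \<alpha> by an element of \<open>H\<close> gives a factor of R again.\<close>
  have coset: "scal_pos M R = H #>\<^bsub>pos_reals\<^esub> \<alpha>"
    if "orthogonal_matrix R" and \<alpha>: "\<alpha> \<in> scal_pos M R" for \<alpha> R
  proof -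
    have "\<alpha> > 0" using \<alpha> scal by blast
    have "\<beta> \<in> (\<lambda>h. h * \<alpha>) ` H" if "\<beta> \<in> scal_pos M R" for \<beta>
    proof -
      have "\<beta> * inverse \<alpha> \<in> scal_pos M (R ** transpose R)"
        using that \<alpha> scal_mult scal_inverse \<open>orthogonal_matrix R\<close> by blast
      then have "\<beta> * inverse \<alpha> \<in> H"
        using \<open>orthogonal_matrix R\<close> by (simp add: H_def orthogonal_matrix_def)
      then show ?thesis
        using \<open>\<alpha> > 0\<close> by (intro image_eqI[of _ _ "\<beta> * inverse \<alpha>"]) auto
    qed
    moreover have "h * \<alpha> \<in> scal_pos M R" if "h \<in> H" for h
      using that scal_mult[of h "mat 1" \<alpha> R] \<alpha> by (simp add: H_def)
    ultimately show ?thesis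
      by (auto simp: r_coset_def pos_reals_def)
  qed

  \<comment> \<open>The group \<open>OS_group M\<close>, the homomorphism and its kernel\<close>
  have OS_mult: "R ** S \<in> OS M" if "R \<in> OS M" "S \<in> OS M" for R S
  proof -
    from that obtain \<alpha> \<beta> where "\<alpha> \<in> scal_pos M R" "\<beta> \<in> scal_pos M S"
      using OS by blast
    then have "\<alpha> * \<beta> \<in> scal_pos M (R ** S)" by (rule scal_mult)
    then show ?thesis using that by (auto simp: OS orthogonal_matrix_mul)
  qed
  interpret G: group "OS_group M"
  proof (rule groupI)
    fix R assume "R \<in> carrier (OS_group M)"
    then have R: "R \<in> OS M" by (simp add: OS_group_def)
    then obtain \<alpha> where "orthogonal_matrix R" "\<alpha> \<in> scal_pos M R"
      using OS by blast
    \<comment> \<open>The inclusion defining \<open>OS\<close> is not visibly stable under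
      inversion, but having a factor that stabilises \<open>V\<close> is.\<close>
    then have "transpose R \<in> OS M"
      using scal_inverse[of R \<alpha>] by (auto simp: OS)
    moreover have "transpose R ** R = mat 1"
      using R OS orthogonal_matrix_def by blast
    ultimately show "\<exists>S\<in>carrier (OS_group M). S \<otimes>\<^bsub>OS_group M\<^esub> R = \<one>\<^bsub>OS_group M\<^esub>"
      by (auto simp: OS_group_def orthogonal_group_def)
  next
    have "mat 1 \<in> OS M"
      using OS scal_one orthogonal_matrix_id by blast
    then show "\<one>\<^bsub>OS_group M\<^esub> \<in> carrier (OS_group M)"
      by (simp add: OS_group_def orthogonal_group_def)
  qed (auto simp: OS_group_def orthogonal_group_def OS_mult matrix_mul_assoc)

  have hom: "scal_pos M \<in> hom (OS_group M) (pos_reals Mod H)"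
  proof (rule homI)
    fix R assume "R \<in> carrier (OS_group M)"
    then have "R \<in> OS M" by (simp add: OS_group_def)
    then obtain \<alpha> where "orthogonal_matrix R" "\<alpha> \<in> scal_pos M R"
      using OS by blast
    then show "scal_pos M R \<in> carrier (pos_reals Mod H)"
      using coset scal by (auto simp: FactGroup_def RCOSETS_def pos_reals_def)
  next
    fix R S assume "R \<in> carrier (OS_group M)" "S \<in> carrier (OS_group M)"
    then have RS: "R \<in> OS M" "S \<in> OS M" by (simp_all add: OS_group_def)
    then obtain \<alpha> \<beta> where \<alpha>: "orthogonal_matrix R" "\<alpha> \<in> scal_pos M R"
      and \<beta>: "orthogonal_matrix S" "\<beta> \<in> scal_pos M S"
      using OS by blast
    \<comment> \<open>The product of representatives \<alpha> and \<beta> is a factor of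
      \<open>R ** S\<close>, so it represents the coset of the product.\<close>
    have "scal_pos M (R ** S) = H #>\<^bsub>pos_reals\<^esub> (\<alpha> \<otimes>\<^bsub>pos_reals\<^esub> \<beta>)"
      using \<alpha> \<beta> coset[OF orthogonal_matrix_mul scal_mult] by (simp add: pos_reals_def)
    also have "\<dots> = (H #>\<^bsub>pos_reals\<^esub> \<alpha>) <#>\<^bsub>pos_reals\<^esub> (H #>\<^bsub>pos_reals\<^esub> \<beta>)"
      using \<alpha> \<beta> scal by (intro H.rcos_sum[symmetric]) (auto simp: pos_reals_def)
    also have "\<dots> = scal_pos M R <#>\<^bsub>pos_reals\<^esub> scal_pos M S"
      using coset \<alpha> \<beta> by simp
    finally show "scal_pos M (R \<otimes>\<^bsub>OS_group M\<^esub> S)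
        = scal_pos M R \<otimes>\<^bsub>pos_reals Mod H\<^esub> scal_pos M S"
      by (simp add: OS_group_def orthogonal_group_def FactGroup_def)
  qed
  interpret Q: comm_group "pos_reals Mod H"
    by (rule P.abelian_FactGroup[OF H_sub])
  interpret \<phi>: group_hom "OS_group M" "pos_reals Mod H" "scal_pos M"
    by unfold_locales (rule hom)
  have ker: "kernel (OS_group M) (pos_reals Mod H) (scal_pos M) = OC M"
  proof -
    \<comment> \<open>\<open>H\<close> is the identity of the quotient and contains 1; conversely,
      if 1 is a factor of R, choosing it as representative gives the coset \<open>H\<close>
      itself.\<close>
    have "scal_pos M R = H \<longleftrightarrow> 1 \<in> scal_pos M R" if "orthogonal_matrix R" for R
      using coset[OF that, of 1] P.coset_mult_one[OF H.subset] scal_one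
      by (auto simp: H_def pos_reals_def)
    then show ?thesis
      using OS OC by (auto simp: kernel_def OS_group_def FactGroup_def)
  qed
  have normal: "OC M \<lhd> OS_group M"
    using \<phi>.normal_kernel ker by simp
  have "comm_group (OS_group M Mod OC M)"
  proof (rule group.group_comm_groupI[OF normal.factorgroup_is_group[OF normal]])
    \<comment> \<open>\<open>?h\<close> is the map induced on the quotient: it sends a coset X to
      the common value of \<open>scal_pos M\<close> on X. It is an injective homomorphism into an
      abelian group, so commutativity pulls back.\<close>
    let ?h = "\<lambda>X. the_elem (scal_pos M ` X)" and ?Q = "OS_group M Mod OC M"
    interpret K: group ?Q by (rule normal.factorgroup_is_group[OF normal])
    have h: "?h \<in> hom ?Q (pos_reals Mod H)" and inj: "inj_on ?h (carrier ?Q)"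
      using \<phi>.FactGroup_hom \<phi>.FactGroup_inj_on ker by simp_all
    fix X Y assume XY: "X \<in> carrier ?Q" "Y \<in> carrier ?Q"
    have "?h (X \<otimes>\<^bsub>?Q\<^esub> Y) = ?h (Y \<otimes>\<^bsub>?Q\<^esub> X)"
      unfolding hom_mult[OF h XY] hom_mult[OF h XY(2,1)]
      using XY h by (intro Q.m_comm) (auto simp: hom_def)
    then show "X \<otimes>\<^bsub>?Q\<^esub> Y = Y \<otimes>\<^bsub>?Q\<^esub> X"
      by (rule inj_onD[OF inj]) (use XY in \<open>blast intro: K.m_closed\<close>)+
  qed
  then show ?thesis
    using H_sub \<phi>.group_hom_axioms ker normal unfolding H_def by blast
qed

end
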